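(* Let $n\geqslant 12$ be an integer. Then the signed Roman domination number of the Kneser graph $K_{n,2}$ satisfies: \begin{itemize} \item if $n$ is odd, then $2\leqslant \gamma_{sR}(K_{n,2})\leqslant 3$; \item if $n$ is even, then $2\leqslant \gamma_{sR}(K_{n,2})\leqslant 5$. \end{itemize}
   Context: The Kneser graph $K_{n,2}$ is the simple graph whose vertices are all $2$-element subsets of $\{1,2,\dots,n\}$, two vertices being adjacent if and only if the corresponding sets are disjoint. Let $G=(V,E)$ be a finite simple graph and, for $v\in V$, let $N[v]=\{v\}\cup\{u\in V \mid uv\in E\}$ be the closed neighborhood of $v$. A signed Roman domination function (SRDF) on $G$ is a function $f:V\to\{-1,1,2\}$ such that: (1) every vertex $v$ with $f(v)=-1$ has a neighbor $u$ with $f(u)=2$; and (2) for every $v\in V$, $\sum_{u\in N[v]}f(u)\geqslant 1$. The weight of $f$ is $f(V)=\sum_{v\in V}f(v)$. The signed Roman domination number $\gamma_{sR}(G)$ is the minimum weight over all SRDFs on $G$. *)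

theory Defs
  imports Main "Graph_Theory.Pair_Digraph"
begin

(* For k = 0 the empty set would be adjacent to itself; the graph is simple for k > 0. *)
definition kneser_graph :: "nat \<Rightarrow> nat \<Rightarrow> nat set pair_pre_digraph" where
  "kneser_graph n k =
     \<lparr> pverts = {A. A \<subseteq> {1..n} \<and> card A = k},
       parcs = {(A, B). A \<subseteq> {1..n} \<and> card A = k \<and> B \<subseteq> {1..n} \<and> card B = k \<and> A \<inter> B = {}} \<rparr>"

definition closed_neighborhood :: "'a pair_pre_digraph \<Rightarrow> 'a \<Rightarrow> 'a set" where
  "closed_neighborhood G v = insert v {u \<in> pverts G. (v, u) \<in> parcs G}"

(* Values of f outside the vertex set are irrelevant. *)
definition is_SRDF :: "'a pair_pre_digraph \<Rightarrow> ('a \<Rightarrow> int) \<Rightarrow> bool" where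
  "is_SRDF G f \<longleftrightarrow>
     (\<forall>v \<in> pverts G. f v \<in> {-1, 1, 2}) \<and>
     (\<forall>v \<in> pverts G. f v = -1 \<longrightarrow> (\<exists>u \<in> pverts G. (v, u) \<in> parcs G \<and> f u = 2)) \<and>
     (\<forall>v \<in> pverts G. (\<Sum>u \<in> closed_neighborhood G v. f u) \<ge> 1)"

definition SRDF_weight :: "'a pair_pre_digraph \<Rightarrow> ('a \<Rightarrow> int) \<Rightarrow> int" where
  "SRDF_weight G f = (\<Sum>v \<in> pverts G. f v)"

definition signed_Roman_domination_number :: "'a pair_pre_digraph \<Rightarrow> int" where
  "signed_Roman_domination_number G = Min {SRDF_weight G f | f. is_SRDF G f}"

lemma pair_graph_kneser_graph:
  assumes "k > 0"
  shows "pair_graph (kneser_graph n k)"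
proof -
  have V: "finite {A. A \<subseteq> {1..n} \<and> card A = k}"
    by (rule finite_subset[of _ "Pow {1..n}"]) auto
  have fin: "finite (parcs (kneser_graph n k))"
    by (rule finite_subset[OF _ finite_cartesian_product[OF V V]])
      (auto simp: kneser_graph_def)
  have sym: "Digraph.symmetric (with_proj (kneser_graph n k))"
    by (simp add: Digraph.symmetric_def kneser_graph_def sym_def Int_commute)
  have loopfree: "A \<noteq> B" if "(A, B) \<in> parcs (kneser_graph n k)" for A B
    using that assms by (auto simp: kneser_graph_def)
  show ?thesis
  proof
    fix e assume e: "e \<in> parcs (kneser_graph n k)"
    show "fst e \<in> pverts (kneser_graph n k)" "snd e \<in> pverts (kneser_graph n k)"
      using e by (simp_all add: kneser_graph_def split: prod.splits)
    show "fst e \<noteq> snd e"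
      using e loopfree[of "fst e" "snd e"] by simp
  next
    show "finite (pverts (kneser_graph n k))"
      using V by (simp add: kneser_graph_def)
  qed (fact fin sym)+
qed

(* On a finite graph the minimum is taken over a finite nonempty set. *)

lemma finite_SRDF_weights:
  assumes "finite (pverts G)"
  shows "finite {SRDF_weight G f | f. is_SRDF G f}"
proof (rule finite_subset)
  let ?m = "int (card (pverts G))"
  have "SRDF_weight G f \<in> {- ?m .. 2 * ?m}" if f: "is_SRDF G f" for f
  proof -
    have b: "- 1 \<le> f v" "f v \<le> 2" if "v \<in> pverts G" for v
    proof -
      have "f v = - 1 \<or> f v = 1 \<or> f v = 2"
        using f that unfolding is_SRDF_def by blast
      then show "- 1 \<le> f v" "f v \<le> 2" by linarith+
    qed
    have "(\<Sum>v \<in> pverts G. - 1) \<le> SRDF_weight G f"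
      unfolding SRDF_weight_def by (rule sum_mono) (rule b)
    moreover have "SRDF_weight G f \<le> (\<Sum>v \<in> pverts G. 2)"
      unfolding SRDF_weight_def by (rule sum_mono) (rule b)
    ultimately show ?thesis by simp
  qed
  then show "{SRDF_weight G f | f. is_SRDF G f} \<subseteq> {- ?m .. 2 * ?m}"
    by blast
qed simp

lemma is_SRDF_const_1:
  assumes "finite (pverts G)"
  shows "is_SRDF G (\<lambda>_. 1)"
proof -
  have "card (closed_neighborhood G v) > 0" for v
    using assms by (simp add: closed_neighborhood_def card_gt_0_iff)
  then show ?thesis
    by (simp add: is_SRDF_def Suc_leI)
qed

lemma signed_Roman_domination_number_attained:
  assumes "finite (pverts G)"
  obtains f where "is_SRDF G f" "SRDF_weight G f = signed_Roman_domination_number G"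
proof -
  have "{SRDF_weight G f | f. is_SRDF G f} \<noteq> {}"
    using is_SRDF_const_1[OF assms] by blast
  from Min_in[OF finite_SRDF_weights[OF assms] this]
  obtain f where "signed_Roman_domination_number G = SRDF_weight G f" "is_SRDF G f"
    unfolding signed_Roman_domination_number_def by (elim CollectE exE conjE)
  then show ?thesis by (intro that) simp_all
qed

lemma signed_Roman_domination_number_le:
  assumes "finite (pverts G)" "is_SRDF G f"
  shows "signed_Roman_domination_number G \<le> SRDF_weight G f"
  unfolding signed_Roman_domination_number_def
  using assms(2) by (intro Min_le finite_SRDF_weights[OF assms(1)]) blast

end

theory Submission
  imports Defs
begin

text \<open>
  Lower bound: every closed neighborhood has the same size \<open>c\<close>, so summing condition (2) over all
  vertices gives \<open>c * W \<ge> |V|\<close>, and \<open>c < |V|\<close> forces \<open>W \<ge> 2\<close>.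

  Upper bound: split \<open>{1..n}\<close> into \<open>N = {1..m}\<close> and its complement \<open>P\<close>, with \<open>n - 2 * m = 3\<close>
  for odd \<open>n\<close> and \<open>n - 2 * m = 4\<close> for even \<open>n\<close>. Pairs across the partition get \<open>-1\<close>, all others
  \<open>1\<close>, except that the edges of a Hamiltonian cycle (\<open>n\<close> odd) or Hamiltonian path (\<open>n\<close> even) on \<open>N\<close>
  get \<open>2\<close>. Up to the cycle or path, the value of a pair is the product of signs attached to its
  elements, so that sums over all pairs of a set reduce to \<open>((\<Sum> g)\<^sup>2 - \<Sum> g\<^sup>2) / 2\<close>.
\<close>

section \<open>Sums of products over two-element sets\<close>

definition pairs :: "'a set \<Rightarrow> 'a set set" where
  "pairs S = {A. A \<subseteq> S \<and> card A = 2}"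

lemma finite_pairs: "finite S \<Longrightarrow> finite (pairs S)"
  unfolding pairs_def by (rule finite_subset[of _ "Pow S"]) auto

lemma pairs_insert:
  assumes "x \<notin> S"
  shows "pairs (insert x S) = pairs S \<union> (\<lambda>y. {x, y}) ` S"
proof (intro equalityI subsetI)
  fix A assume A: "A \<in> pairs (insert x S)"
  then obtain a b where "A = {a, b}" "a \<noteq> b"
    by (auto simp: pairs_def card_2_iff)
  with A show "A \<in> pairs S \<union> (\<lambda>y. {x, y}) ` S"
    by (auto simp: pairs_def)
next
  fix A assume "A \<in> pairs S \<union> (\<lambda>y. {x, y}) ` S"
  then show "A \<in> pairs (insert x S)"
    using assms by (auto simp: pairs_def card_2_iff)
qed

text \<open>Adding \<open>x\<close> to \<open>S\<close> creates the pairs \<open>{x, y}\<close>,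
  which contribute \<open>g x * sum g S\<close>: half the cross term of the square of
  \<open>g x + sum g S\<close>.\<close>

lemma sum_prod_pairs:
  fixes g :: "'a \<Rightarrow> 'b :: comm_ring_1"
  assumes "finite S"
  shows "2 * (\<Sum>A\<in>pairs S. prod g A) = (sum g S)\<^sup>2 - (\<Sum>x\<in>S. (g x)\<^sup>2)"
  using assms
proof (induction S)
  case empty
  have "pairs ({} :: 'a set) = {}"
    by (auto simp: pairs_def)
  then show ?case by simp
next
  case (insert x S)
  have inj: "inj_on (\<lambda>y. {x, y}) S"
    by (auto simp: inj_on_def doubleton_eq_iff)
  have "(\<Sum>A\<in>pairs (insert x S). prod g A)
      = (\<Sum>A\<in>pairs S. prod g A) + (\<Sum>A\<in>(\<lambda>y. {x, y}) ` S. prod g A)"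
    unfolding pairs_insert[OF insert.hyps(2)]
    using insert.hyps by (intro sum.union_disjoint) (auto simp: finite_pairs, auto simp: pairs_def)
  also have "(\<Sum>A\<in>(\<lambda>y. {x, y}) ` S. prod g A) = (\<Sum>y\<in>S. prod g {x, y})"
    by (simp add: sum.reindex[OF inj])
  also have "\<dots> = (\<Sum>y\<in>S. g x * g y)"
    using insert.hyps by (intro sum.cong refl) (subst prod.insert, auto)
  also have "\<dots> = g x * sum g S"
    by (simp add: sum_distrib_left)
  finally show ?case
    using insert by (simp add: algebra_simps power2_eq_square)
qed

section \<open>Closed neighborhoods in the Kneser graph\<close>

lemma pverts_kneser_graph_2: "pverts (kneser_graph n 2) = pairs {1..n}"
  by (simp add: kneser_graph_def pairs_def)

lemma closed_neighborhood_kneser_graph_2: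
  assumes "A \<in> pairs {1..n}"
  shows "closed_neighborhood (kneser_graph n 2) A = insert A (pairs ({1..n} - A))"
  using assms by (auto simp: closed_neighborhood_def kneser_graph_def pairs_def)

lemma pairs_Diff:
  assumes "finite S" "A \<in> pairs S"
  shows "finite (pairs (S - A))" "A \<notin> pairs (S - A)"
    "card (insert A (pairs (S - A))) = Suc ((card S - 2) choose 2)"
proof -
  show fin: "finite (pairs (S - A))"
    using assms by (simp add: finite_pairs)
  show notin: "A \<notin> pairs (S - A)"
    using assms(2) by (auto simp: pairs_def card_2_iff)
  have "card (S - A) = card S - 2"
    using assms card_Diff_subset[of A S] by (auto simp: pairs_def intro: finite_subset)
  then have "card (pairs (S - A)) = (card S - 2) choose 2"
    unfolding pairs_def using n_subsets[of "S - A" 2] assms(1) by simp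
  with fin notin show "card (insert A (pairs (S - A))) = Suc ((card S - 2) choose 2)"
    by simp
qed

section \<open>Lower bound by double counting\<close>

lemma SRDF_weight_ge_2:
  assumes fin: "finite (pverts G)"
    and sym: "\<And>u v. (u, v) \<in> parcs G \<Longrightarrow> (v, u) \<in> parcs G"
    and card: "\<And>v. v \<in> pverts G \<Longrightarrow> card (closed_neighborhood G v) = c"
    and less: "c < card (pverts G)"
    and f: "is_SRDF G f"
  shows "SRDF_weight G f \<ge> 2"
proof -
  let ?V = "pverts G" and ?N = "closed_neighborhood G"
  have N: "?N v = {u \<in> ?V. u \<in> ?N v}" if "v \<in> ?V" for v
    using that by (auto simp: closed_neighborhood_def)
  have swap: "u \<in> ?N v \<longleftrightarrow> v \<in> ?N u" if "u \<in> ?V" "v \<in> ?V" for u v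
    using that sym by (auto simp: closed_neighborhood_def)
  have "int (card ?V) = (\<Sum>v\<in>?V. 1)" by simp
  also have "\<dots> \<le> (\<Sum>v\<in>?V. \<Sum>u\<in>?N v. f u)"
    using f by (intro sum_mono) (simp add: is_SRDF_def)
  also have "\<dots> = (\<Sum>v\<in>?V. \<Sum>u | u \<in> ?V \<and> u \<in> ?N v. f u)"
    using N by (intro sum.cong refl) simp
  \<comment> \<open>After the exchange, \<open>f u\<close> is counted once for every
    \<open>v\<close> whose closed neighborhood contains \<open>u\<close>. By symmetry of adjacency
    these \<open>v\<close> form the closed neighborhood of \<open>u\<close>, so there are
    \<open>c\<close> of them.\<close>
  also have "\<dots> = (\<Sum>u\<in>?V. \<Sum>v | v \<in> ?V \<and> u \<in> ?N v. f u)"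
    using fin by (intro sum.swap_restrict)
  also have "\<dots> = (\<Sum>u\<in>?V. int c * f u)"
  proof (intro sum.cong refl)
    fix u assume u: "u \<in> ?V"
    have "{v \<in> ?V. u \<in> ?N v} = ?N u"
      using N[OF u] swap[OF u] by blast
    then show "(\<Sum>v | v \<in> ?V \<and> u \<in> ?N v. f u) = int c * f u"
      using card[OF u] by simp
  qed
  also have "\<dots> = int c * SRDF_weight G f"
    by (simp add: SRDF_weight_def sum_distrib_left)
  finally have "int c * 1 < int c * SRDF_weight G f"
    using less by simp
  then have "1 < SRDF_weight G f"
    by (rule mult_left_less_imp_less) simp
  then show ?thesis by simp
qed

lemma SRDF_weight_kneser_graph_2_ge_2:
  assumes n: "n \<ge> 4" and f: "is_SRDF (kneser_graph n 2) f"
  shows "SRDF_weight (kneser_graph n 2) f \<ge> 2"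
proof (rule SRDF_weight_ge_2[OF _ _ _ _ f])
  let ?c = "Suc ((n - 2) choose 2)"
  show "card (closed_neighborhood (kneser_graph n 2) A) = ?c"
    if "A \<in> pverts (kneser_graph n 2)" for A
    using that pairs_Diff(3)[of "{1..n}" A]
    by (simp add: pverts_kneser_graph_2 closed_neighborhood_kneser_graph_2)
  show "finite (pverts (kneser_graph n 2))"
    by (simp add: pverts_kneser_graph_2 finite_pairs)
  show "?c < card (pverts (kneser_graph n 2))"
  proof -
    \<comment> \<open>With \<open>n = k + 2\<close>, Pascal's rule gives
      \<open>n choose 2 = (k choose 2) + 2 * k + 1\<close>, which exceeds
      \<open>Suc (k choose 2)\<close> as soon as \<open>k\<close> is positive.\<close>
    obtain k where k: "n = Suc (Suc k)" "k \<ge> 1"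
      using n by (cases n; cases "n - 1") auto
    have "card (pverts (kneser_graph n 2)) = n choose 2"
      unfolding pverts_kneser_graph_2 pairs_def by (simp add: n_subsets)
    then show ?thesis
      using k by (simp add: numeral_2_eq_2)
  qed
qed (auto simp: kneser_graph_def)

section \<open>Functions built from a partition into two blocks\<close>

lemma sum_prod_pairs_indicator:
  fixes g :: "'a \<Rightarrow> int"
  assumes "finite S" "\<And>x. x \<in> S \<Longrightarrow> (g x)\<^sup>2 = 1"
  shows "2 * (\<Sum>A\<in>pairs S. prod g A + of_bool (A \<in> R))
       = (sum g S)\<^sup>2 - int (card S) + 2 * int (card (R \<inter> pairs S))"
proof -
  have "(\<Sum>A\<in>pairs S. of_bool (A \<in> R)) = int (card (R \<inter> pairs S))"
    using assms(1) by (simp add: finite_pairs sum.inter_restrict[symmetric] of_bool_def Int_commute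
        flip: sum.inter_filter)
  moreover have "(\<Sum>x\<in>S. (g x)\<^sup>2) = int (card S)"
    using assms(2) by simp
  ultimately show ?thesis
    using sum_prod_pairs[OF assms(1), of g] by (simp add: sum.distrib algebra_simps)
qed

text \<open>Discard from \<open>R\<close> the members through \<open>u\<close> and those through
  \<open>v\<close>. The pair \<open>{u, v}\<close> itself may be subtracted twice, so only an
  inequality results.\<close>

lemma card_avoid_ge:
  assumes "finite R" "R \<subseteq> pairs S"
  shows "int (card (R \<inter> pairs (S - {u, v})))
       \<ge> int (card R) - int (card {B \<in> R. u \<in> B}) - int (card {B \<in> R. v \<in> B})"
proof -
  have "R \<subseteq> (R \<inter> pairs (S - {u, v})) \<union> {B \<in> R. u \<in> B} \<union> {B \<in> R. v \<in> B}"
    using assms(2) by (auto simp: pairs_def)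
  then have "card R \<le> card ((R \<inter> pairs (S - {u, v})) \<union> {B \<in> R. u \<in> B} \<union> {B \<in> R. v \<in> B})"
    using assms(1) by (intro card_mono) auto
  also have "\<dots> \<le> card (R \<inter> pairs (S - {u, v})) + card {B \<in> R. u \<in> B} + card {B \<in> R. v \<in> B}"
    by (meson add_mono card_Un_le le_refl order_trans)
  finally show ?thesis by linarith
qed

definition block_sign :: "nat \<Rightarrow> nat \<Rightarrow> int" where
  "block_sign m i = (if i \<le> m then - 1 else 1)"

definition block_SRDF :: "nat \<Rightarrow> nat set set \<Rightarrow> nat set \<Rightarrow> int" where
  "block_SRDF m R A = prod (block_sign m) A + of_bool (A \<in> R)"

lemma sum_block_sign:
  assumes "m \<le> n"
  shows "sum (block_sign m) {1..n} = int n - 2 * int m"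
proof -
  have "{1..n} = {1..m} \<union> {m<..n}" using assms by auto
  then have "sum (block_sign m) {1..n} = sum (block_sign m) {1..m} + sum (block_sign m) {m<..n}"
    by (simp only:) (rule sum.union_disjoint, auto)
  also have "\<dots> = (\<Sum>i\<in>{1..m}. - 1) + (\<Sum>i\<in>{m<..n}. 1)"
    by (intro arg_cong2[where f = "(+)"] sum.cong) (auto simp: block_sign_def)
  finally show ?thesis using assms by simp
qed

lemma SRDF_weight_block:
  assumes "m \<le> n" "R \<subseteq> pairs {1..m}"
  shows "2 * SRDF_weight (kneser_graph n 2) (block_SRDF m R)
       = (int n - 2 * int m)\<^sup>2 - int n + 2 * int (card R)"
proof -
  have "pairs {1..m} \<subseteq> pairs {1..n}"
    using assms(1) by (auto simp: pairs_def)
  with assms(2) have "R \<inter> pairs {1..n} = R" by blast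
  moreover have "(block_sign m x)\<^sup>2 = 1" for x
    by (simp add: block_sign_def)
  ultimately show ?thesis
    using sum_prod_pairs_indicator[of "{1..n}" "block_sign m" R] sum_block_sign[OF assms(1)]
    by (simp add: SRDF_weight_def pverts_kneser_graph_2 block_SRDF_def)
qed

text \<open>\<open>avoid\<close> supplies the neighbor of value 2 that condition (1) asks for.
  Condition (2) splits by the position of the pair: \<open>P\<close> is exactly what a pair above
  \<open>m\<close> needs, and \<open>N\<close> covers mixed pairs and pairs inside
  \<open>{1..m}\<close>, where \<open>deg\<close> bounds the members of \<open>R\<close>
  lost.\<close>

lemma is_SRDF_block:
  assumes mn: "2 * m \<le> n" and R: "R \<subseteq> pairs {1..m}"
    and deg: "\<And>v. card {B \<in> R. v \<in> B} \<le> 2"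
    and avoid: "\<And>v. \<exists>B\<in>R. v \<notin> B"
    and P: "(int n - 2 * int m - 2)\<^sup>2 + 2 * int (card R) \<ge> int n - 2"
    and N: "(int n - 2 * int m)\<^sup>2 + 2 * int (card R) \<ge> int n + 6"
  shows "is_SRDF (kneser_graph n 2) (block_SRDF m R)"
  unfolding is_SRDF_def pverts_kneser_graph_2
proof (intro conjI ballI impI)
  let ?f = "block_SRDF m R" and ?g = "block_sign m"
  fix A assume A: "A \<in> pairs {1..n}"
  then obtain a b where "A = {a, b}" "a \<noteq> b"
    by (auto simp: pairs_def card_2_iff)
  \<comment> \<open>Ordering the elements leaves three cases for the position of \<open>m\<close>,
    and forces \<open>u\<close> \<le> \<open>m\<close> < \<open>v\<close> whenever the value is
    -1.\<close>
  then have "A = {min a b, max a b}" "min a b < max a b"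
    by (auto simp: min_def max_def)
  then obtain u v where uv: "A = {u, v}" "u < v" by blast
  have prod: "prod ?g A = ?g u * ?g v"
    using uv by simp
  have "pairs {1..m} \<subseteq> pairs {1..n}"
    using mn by (auto simp: pairs_def)
  with R have Rn: "R \<subseteq> pairs {1..n}" by blast
  have R_le: "x \<le> m" if "B \<in> R" "x \<in> B" for B x
    using that subsetD[OF R] by (fastforce simp: pairs_def)
  show "?f A \<in> {- 1, 1, 2}"
    using R_le[of A u] R_le[of A v] prod uv by (auto simp: block_SRDF_def block_sign_def)
  show "\<exists>B\<in>pairs {1..n}. (A, B) \<in> parcs (kneser_graph n 2) \<and> ?f B = 2" if "?f A = - 1"
  proof -
    from that have "m < v"
      using prod uv by (auto simp: block_SRDF_def block_sign_def of_bool_def split: if_splits)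
    obtain B where B: "B \<in> R" "u \<notin> B" using avoid by blast
    with \<open>m < v\<close> have "A \<inter> B = {}"
      using R_le[of B v] uv by auto
    moreover have B': "B \<in> pairs {1..n}" "B \<subseteq> {1..m}"
      using B(1) R Rn unfolding pairs_def by blast+
    moreover have "?f B = 2"
    proof -
      have "prod ?g B = (\<Prod>x\<in>B. - 1)"
        using B' by (intro prod.cong) (auto simp: block_sign_def)
      then show ?thesis
        using B B' by (simp add: block_SRDF_def pairs_def)
    qed
    ultimately show ?thesis
      using A by (intro bexI[of _ B]) (auto simp: kneser_graph_def pairs_def)
  qed
  let ?S = "{1..n} - A"
  have uvn: "u \<in> {1..n}" "v \<in> {1..n}" using A uv by (auto simp: pairs_def)
  have finR: "finite R"
    using R finite_pairs[of "{1..m}"] finite_subset by blast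
  have cR: "int (card (R \<inter> pairs ?S))
       \<ge> int (card R) - int (card {B \<in> R. u \<in> B}) - int (card {B \<in> R. v \<in> B})"
    unfolding uv using finR Rn by (rule card_avoid_ge)
  have "card ?S = n - 2"
    using A card_Diff_subset[of A "{1..n}"] by (auto simp: pairs_def uv)
  moreover have "n \<ge> 2" using uvn uv by auto
  moreover have "sum ?g {1..n} = sum ?g ?S + sum ?g A"
    using A by (intro sum.subset_diff) (auto simp: pairs_def)
  then have "sum ?g ?S = int n - 2 * int m - ?g u - ?g v"
    using sum_block_sign[of m n] mn uv by simp
  ultimately have S: "2 * (\<Sum>B\<in>pairs ?S. ?f B)
      = (int n - 2 * int m - ?g u - ?g v)\<^sup>2 - (int n - 2) + 2 * int (card (R \<inter> pairs ?S))"
    unfolding block_SRDF_def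
    using sum_prod_pairs_indicator[of ?S ?g R] by (auto simp: block_sign_def)
  have fA: "?f A \<ge> ?g u * ?g v" by (simp add: block_SRDF_def prod)
  have "2 * (\<Sum>B\<in>pairs ?S. ?f B) + 2 * ?f A \<ge> 2"
  proof (cases "m < v")
    case v: True
    then have "{B \<in> R. v \<in> B} = {}" using R_le by fastforce
    then have v0: "card {B \<in> R. v \<in> B} = 0" by (simp only: card.empty)
    show ?thesis
    proof (cases "m < u")
      case True
      then have "{B \<in> R. u \<in> B} = {}" using R_le by fastforce
      then have "card {B \<in> R. u \<in> B} = 0" by (simp only: card.empty)
      then show ?thesis
        using S cR v0 v True fA P by (simp add: block_sign_def)
    next
      \<comment> \<open>Mixed pair: the two signs cancel in the sum. At most two members of
        \<open>R\<close> are lost, costing 4 in the doubled count, and the value -1 of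
        \<open>A\<close> costs 2; reaching 2 from there requires the bound \<open>n + 6\<close> in
        \<open>N\<close>.\<close>
      case False
      then show ?thesis
        using S cR v0 v fA N deg[of u] by (simp add: block_sign_def)
    qed
  next
    case False
    \<comment> \<open>Both elements lie in the negative block, so removing them raises the sum of
      signs by 2. Up to four members of \<open>R\<close> may be lost, but \<open>A\<close> now
      contributes at least 1, so \<open>N\<close> suffices again.\<close>
    moreover have "(int n - 2 * int m)\<^sup>2 \<le> (2 + (int n - 2 * int m))\<^sup>2"
      using mn by (intro power_mono) auto
    ultimately show ?thesis
      using S cR fA N deg[of u] deg[of v] \<open>u < v\<close> by (simp add: block_sign_def)
  qed
  then show "(\<Sum>B\<in>closed_neighborhood (kneser_graph n 2) A. ?f B) \<ge> 1"
    using pairs_Diff(1,2)[of "{1..n}" A] A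
    by (simp add: closed_neighborhood_kneser_graph_2)
qed

section \<open>Edges of a cycle or path on the negative block\<close>

text \<open>The first \<open>k\<close> edges of the cycle \<open>1, 2, \<dots>, m, 1\<close>.\<close>

definition cycle_edges :: "nat \<Rightarrow> nat \<Rightarrow> nat set set" where
  "cycle_edges m k = (\<lambda>i. {i, if i = m then 1 else Suc i}) ` {1..k}"

lemma cycle_edges_subset: "k \<le> m \<Longrightarrow> m \<ge> 2 \<Longrightarrow> cycle_edges m k \<subseteq> pairs {1..m}"
  by (auto simp: cycle_edges_def pairs_def card_insert_if)

lemma card_cycle_edges:
  assumes "k \<le> m" "m \<ge> 3"
  shows "card (cycle_edges m k) = k"
proof -
  have "inj_on (\<lambda>i. {i, if i = m then 1 else Suc i}) {1..k}"
    using assms by (auto simp: inj_on_def doubleton_eq_iff split: if_splits)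
  then show ?thesis
    by (simp add: cycle_edges_def card_image)
qed

text \<open>Edge \<open>i\<close> joins \<open>i\<close> to its cyclic successor, so an edge through
  \<open>v\<close> has index \<open>v\<close> or the cyclic predecessor of \<open>v\<close>.\<close>

lemma card_cycle_edges_incident:
  assumes "k \<le> m"
  shows "card {B \<in> cycle_edges m k. v \<in> B} \<le> 2"
proof -
  let ?e = "\<lambda>i. {i, if i = m then 1 else Suc i}"
  have "{B \<in> cycle_edges m k. v \<in> B} \<subseteq> ?e ` {v, if v = 1 then m else v - 1}"
  proof
    fix B assume "B \<in> {B \<in> cycle_edges m k. v \<in> B}"
    then obtain i where i: "i \<in> {1..k}" "B = ?e i" "v \<in> ?e i"
      unfolding cycle_edges_def by blast
    then have "i \<in> {v, if v = 1 then m else v - 1}"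
      by (cases "i = m") auto
    with i(2) show "B \<in> ?e ` {v, if v = 1 then m else v - 1}"
      by (intro image_eqI)
  qed
  then have "card {B \<in> cycle_edges m k. v \<in> B} \<le> card (?e ` {v, if v = 1 then m else v - 1})"
    by (intro card_mono) auto
  also have "\<dots> \<le> card {v, if v = 1 then m else v - 1}"
    by (intro card_image_le) simp
  also have "\<dots> \<le> 2"
    by (simp add: card_insert_if)
  finally show ?thesis .
qed

text \<open>The edges \<open>{1, 2}\<close> and \<open>{3, 4}\<close> are disjoint, so
  \<open>v\<close> misses one of them. The bounds ensure that edge 3 is present and does not wrap
  around to 1.\<close>

lemma cycle_edges_avoid:
  assumes "3 \<le> k" "m \<ge> 4"
  shows "\<exists>B\<in>cycle_edges m k. v \<notin> B"
proof (cases "v \<in> {1, 2}")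
  case True
  have "{3, 4} \<in> cycle_edges m k"
    unfolding cycle_edges_def using assms by (intro image_eqI[of _ _ 3]) auto
  with True show ?thesis by (intro bexI[of _ "{3, 4}"]) auto
next
  case False
  have "{1, 2} \<in> cycle_edges m k"
    unfolding cycle_edges_def using assms by (intro image_eqI[of _ _ 1]) auto
  with False show ?thesis by (intro bexI[of _ "{1, 2}"]) auto
qed

section \<open>Upper bound and conclusion\<close>

lemma signed_Roman_domination_number_kneser_graph_2_le:
  assumes "2 * m \<le> n" "m \<ge> 4" "3 \<le> k" "k \<le> m"
    and "(int n - 2 * int m - 2)\<^sup>2 + 2 * int k \<ge> int n - 2"
    and "(int n - 2 * int m)\<^sup>2 + 2 * int k \<ge> int n + 6"
  shows "2 * signed_Roman_domination_number (kneser_graph n 2)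
       \<le> (int n - 2 * int m)\<^sup>2 - int n + 2 * int k"
proof -
  let ?R = "cycle_edges m k"
  have c: "card ?R = k" and R: "?R \<subseteq> pairs {1..m}"
    using assms card_cycle_edges[of k m] cycle_edges_subset[of k m] by simp_all
  have "is_SRDF (kneser_graph n 2) (block_SRDF m ?R)"
    using assms R c by (intro is_SRDF_block card_cycle_edges_incident cycle_edges_avoid) auto
  then have "signed_Roman_domination_number (kneser_graph n 2)
      \<le> SRDF_weight (kneser_graph n 2) (block_SRDF m ?R)"
    by (intro signed_Roman_domination_number_le) (simp_all add: pverts_kneser_graph_2 finite_pairs)
  then show ?thesis
    using SRDF_weight_block[of m n ?R] R c assms(1) by simp
qed

theorem theorem3:
  fixes n :: nat
  assumes "n \<ge> 12"
  shows "(odd n \<longrightarrow>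
            2 \<le> signed_Roman_domination_number (kneser_graph n 2) \<and>
            signed_Roman_domination_number (kneser_graph n 2) \<le> 3) \<and>
         (even n \<longrightarrow>
            2 \<le> signed_Roman_domination_number (kneser_graph n 2) \<and>
            signed_Roman_domination_number (kneser_graph n 2) \<le> 5)"
proof (intro conjI impI)
  have "finite (pverts (kneser_graph n 2))"
    by (simp add: pverts_kneser_graph_2 finite_pairs)
  then obtain f where "is_SRDF (kneser_graph n 2) f"
    "SRDF_weight (kneser_graph n 2) f = signed_Roman_domination_number (kneser_graph n 2)"
    by (rule signed_Roman_domination_number_attained)
  then show "2 \<le> signed_Roman_domination_number (kneser_graph n 2)"
    using SRDF_weight_kneser_graph_2_ge_2[of n f] assms by simp
  then show "2 \<le> signed_Roman_domination_number (kneser_graph n 2)" .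
next
  assume "odd n"
  then obtain j where "n = 2 * j + 1" by (rule oddE)
  then obtain m where "n = 2 * m + 3" "m \<ge> 5"
    using assms by (intro that[of "j - 1"]) auto
  then show "signed_Roman_domination_number (kneser_graph n 2) \<le> 3"
    \<comment> \<open>placeholder\<close>
    using signed_Roman_domination_number_kneser_graph_2_le[of m n m] by simp
next
  assume "even n"
  then obtain j where "n = 2 * j" by (rule evenE)
  then obtain m where "n = 2 * m + 4" "m \<ge> 4"
    using assms by (intro that[of "j - 2"]) auto
  then show "signed_Roman_domination_number (kneser_graph n 2) \<le> 5"
    using signed_Roman_domination_number_kneser_graph_2_le[of m n "m - 1"] by (simp add: of_nat_diff)
qed

end
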